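(* Let $m\ge 1$ and let $U=\mathrm{Mat}_m$ be the space of complex $m\times m$ matrices. For generic $(a_1,a_2)\in U\times U$ put $\mu(a_1,a_2)=(b_1,b_2)$, where $(b_1,b_2)\in U\times U$ is the pair of matrices determined by $$b_1+b_2=a_1+a_2,\qquad b_1b_2=a_1a_2,\qquad S(b_1)=S(a_2),\qquad S(b_2)=S(a_1).$$ Then $\mu$ is a twisted transposition on $U$. Moreover, $$\mu(a_1,a_2)=(a_1+\Lambda^{-1},\,a_2-\Lambda^{-1}),$$ where $\Lambda\in \mathrm{Mat}_m$ is the solution of the linear matrix equation $a_2\Lambda-\Lambda a_1=1$ (with $1$ the identity matrix).
   Context: For a matrix $a\in \mathrm{Mat}_m$, $S(a)$ denotes the set of eigenvalues of $a$. "Generic" means: for all points outside some proper Zariski-closed subset (so in particular $S(a_1)$ and $S(a_2)$ each have $m$ elements and are disjoint). Twisted transposition: let $U$ be a complex manifold and $\mu:U\times U\to U\times U$ a birational automorphism. Define birational automorphisms of $U\times U\times U$ by $\sigma_1=\mu\times \mathrm{id}$ and $\sigma_2=\mathrm{id}\times\mu$. Then $\mu$ is called a twisted transposition if $\sigma_1^2=\sigma_2^2=\mathrm{id}$ and $\sigma_1\sigma_2\sigma_1=\sigma_2\sigma_1\sigma_2$ (equalities of birational maps). *)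

theory Defs
  imports "HOL-Analysis.Analysis"
begin

text \<open>
  Types carrying a finite system of coordinate functions that identifies them with
  some affine space over the complex numbers.
\<close>

class complex_affine =
  fixes coords :: "('a \<Rightarrow> complex) set"
  assumes finite_coords: "finite coords"
    and ex1_coords: "\<exists>!x. \<forall>c\<in>coords. c x = v c"

instantiation complex :: complex_affine
begin

definition coords_complex :: "(complex \<Rightarrow> complex) set"
  where "coords_complex = {\<lambda>z. z}"

instance
  by standard (auto simp: coords_complex_def)

end

instantiation prod :: (complex_affine, complex_affine) complex_affine
begin

definition coords_prod :: "('a \<times> 'b \<Rightarrow> complex) set"
  where "coords_prod = (\<lambda>c x. c (fst x)) ` coords \<union> (\<lambda>c x. c (snd x)) ` coords"

instance
proof
  show "finite (coords :: ('a \<times> 'b \<Rightarrow> complex) set)"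
    by (simp add: coords_prod_def finite_coords)
next
  fix v :: "('a \<times> 'b \<Rightarrow> complex) \<Rightarrow> complex"
  obtain a :: 'a where a: "\<And>x. (\<forall>c\<in>coords. c x = v (\<lambda>p. c (fst p))) \<longleftrightarrow> x = a"
    using ex1_coords[of "\<lambda>c. v (\<lambda>p. c (fst p))"] by metis
  obtain b :: 'b where b: "\<And>x. (\<forall>c\<in>coords. c x = v (\<lambda>p. c (snd p))) \<longleftrightarrow> x = b"
    using ex1_coords[of "\<lambda>c. v (\<lambda>p. c (snd p))"] by metis
  have "(\<forall>c\<in>coords. c x = v c) \<longleftrightarrow> fst x = a \<and> snd x = b" for x
    unfolding coords_prod_def ball_Un a[symmetric] b[symmetric] by simp
  then show "\<exists>!x. \<forall>c\<in>coords. c x = v c"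
    by (metis fst_conv snd_conv prod_eqI)
qed

end

instantiation vec :: (complex_affine, finite) complex_affine
begin

definition coords_vec :: "('a ^ 'b \<Rightarrow> complex) set"
  where "coords_vec = (\<Union>i. (\<lambda>c x. c (x $ i)) ` coords)"

instance
proof
  show "finite (coords :: ('a ^ 'b \<Rightarrow> complex) set)"
    by (simp add: coords_vec_def finite_coords)
next
  fix v :: "('a ^ 'b \<Rightarrow> complex) \<Rightarrow> complex"
  have "\<exists>a. \<forall>i. \<forall>x. (\<forall>c\<in>coords. c x = v (\<lambda>p. c (p $ i))) \<longleftrightarrow> x = a i"
  proof (rule choice, rule allI)
    fix i :: 'b
    show "\<exists>a. \<forall>x. (\<forall>c\<in>coords. c x = v (\<lambda>p. c (p $ i))) \<longleftrightarrow> x = a"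
      using ex1_coords[of "\<lambda>c. v (\<lambda>p. c (p $ i))"] by metis
  qed
  then obtain a :: "'b \<Rightarrow> 'a"
    where a: "\<And>i x. (\<forall>c\<in>coords. c x = v (\<lambda>p. c (p $ i))) \<longleftrightarrow> x = a i"
    by blast
  have "(\<forall>c\<in>coords. c x = v c) \<longleftrightarrow> (\<forall>i. x $ i = a i)" for x
    unfolding coords_vec_def a[symmetric] by auto
  then have "(\<forall>c\<in>coords. c x = v c) \<longleftrightarrow> x = (\<chi> i. a i)" for x
    by (simp add: vec_eq_iff)
  then show "\<exists>!x. \<forall>c\<in>coords. c x = v c"
    by simp
qed

end


inductive polynomial_fun :: "('a::complex_affine \<Rightarrow> complex) \<Rightarrow> bool" where
  coord: "c \<in> coords \<Longrightarrow> polynomial_fun c"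
| const: "polynomial_fun (\<lambda>x. k)"
| add: "polynomial_fun p \<Longrightarrow> polynomial_fun q \<Longrightarrow> polynomial_fun (\<lambda>x. p x + q x)"
| mult: "polynomial_fun p \<Longrightarrow> polynomial_fun q \<Longrightarrow> polynomial_fun (\<lambda>x. p x * q x)"

definition zariski_closed :: "'a::complex_affine set \<Rightarrow> bool" where
  "zariski_closed Z \<longleftrightarrow> (\<exists>P. (\<forall>p\<in>P. polynomial_fun p) \<and> Z = {x. \<forall>p\<in>P. p x = 0})"

definition generically :: "('a::complex_affine \<Rightarrow> bool) \<Rightarrow> bool" where
  "generically Q \<longleftrightarrow> (\<exists>Z. zariski_closed Z \<and> Z \<noteq> UNIV \<and> (\<forall>x. x \<notin> Z \<longrightarrow> Q x))"

text \<open>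
  A rational map is represented by a total function whose values on some proper
  Zariski-closed set are irrelevant. Two functions represent the same rational map
  iff they agree generically.
\<close>

definition same_rational_map :: "('a::complex_affine \<Rightarrow> 'b) \<Rightarrow> ('a \<Rightarrow> 'b) \<Rightarrow> bool" where
  "same_rational_map f g \<longleftrightarrow> generically (\<lambda>x. f x = g x)"

definition rational_map :: "('a::complex_affine \<Rightarrow> 'b::complex_affine) \<Rightarrow> bool" where
  "rational_map f \<longleftrightarrow> (\<forall>c\<in>coords. \<exists>p q. polynomial_fun p \<and> polynomial_fun q \<and>
     generically (\<lambda>x. q x \<noteq> 0 \<and> c (f x) = p x / q x))"

text \<open>
  If two self-maps are generically inverse to each other, then each is injective on a
  nonempty Zariski-open set, hence dominant. So composing representatives of birational
  automorphisms represents the composite birational map, independently of the choice of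
  representatives.
\<close>

definition birational_automorphism :: "('a::complex_affine \<Rightarrow> 'a) \<Rightarrow> bool" where
  "birational_automorphism f \<longleftrightarrow> rational_map f \<and>
     (\<exists>g. rational_map g \<and> same_rational_map (g \<circ> f) id \<and> same_rational_map (f \<circ> g) id)"

definition sigma1 :: "('u \<times> 'u \<Rightarrow> 'u \<times> 'u) \<Rightarrow> 'u \<times> 'u \<times> 'u \<Rightarrow> 'u \<times> 'u \<times> 'u" where
  "sigma1 \<mu> = (\<lambda>(x, y, z). let (x', y') = \<mu> (x, y) in (x', y', z))"

definition sigma2 :: "('u \<times> 'u \<Rightarrow> 'u \<times> 'u) \<Rightarrow> 'u \<times> 'u \<times> 'u \<Rightarrow> 'u \<times> 'u \<times> 'u" where
  "sigma2 \<mu> = (\<lambda>(x, y, z). let (y', z') = \<mu> (y, z) in (x, y', z'))"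

definition twisted_transposition ::
  "('u::complex_affine \<times> 'u \<Rightarrow> 'u \<times> 'u) \<Rightarrow> bool" where
  "twisted_transposition \<mu> \<longleftrightarrow> birational_automorphism \<mu> \<and>
     same_rational_map (sigma1 \<mu> \<circ> sigma1 \<mu>) id \<and>
     same_rational_map (sigma2 \<mu> \<circ> sigma2 \<mu>) id \<and>
     same_rational_map (sigma1 \<mu> \<circ> sigma2 \<mu> \<circ> sigma1 \<mu>) (sigma2 \<mu> \<circ> sigma1 \<mu> \<circ> sigma2 \<mu>)"


definition eigenvalues :: "complex ^ 'm ^ 'm \<Rightarrow> complex set" where
  "eigenvalues a = {l. \<exists>v. v \<noteq> 0 \<and> a *v v = l *s v}"

definition refactorization ::
  "(complex ^ 'm ^ 'm) \<times> (complex ^ 'm ^ 'm) \<Rightarrow> (complex ^ 'm ^ 'm) \<times> (complex ^ 'm ^ 'm) \<Rightarrow> bool"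
where
  "refactorization = (\<lambda>(a1, a2) (b1, b2).
     b1 + b2 = a1 + a2 \<and> b1 ** b2 = a1 ** a2 \<and>
     eigenvalues b1 = eigenvalues a2 \<and> eigenvalues b2 = eigenvalues a1)"

text \<open>
  Only meaningful at points where the refactorization exists and is unique; elsewhere
  the value is arbitrary.
\<close>

definition refactorization_map ::
  "(complex ^ 'm ^ 'm) \<times> (complex ^ 'm ^ 'm) \<Rightarrow> (complex ^ 'm ^ 'm) \<times> (complex ^ 'm ^ 'm)"
where
  "refactorization_map a = (THE b. refactorization a b)"

end

theory Submission
  imports Defs "HOL-Computational_Algebra.Fundamental_Theorem_Algebra"
begin

text \<open>
  The equations for \<open>(b1, b2)\<close> say that the pencils \<open>(t - b1) (t - b2)\<close> and \<open>(t - a1) (t - a2)\<close>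
  coincide and that the spectra are exchanged.

  \<^emph>\<open>Uniqueness.\<close> If \<open>t\<close> is an eigenvalue of the last factor and the factors before it have no
  eigenvalue \<open>t\<close>, then the kernel of the product at \<open>t\<close> is the kernel of the last factor. Hence the
  pencil and the spectrum determine the eigenvectors of the last factor, and with \<open>m\<close> distinct
  eigenvalues they determine the factor itself (\<open>last_factor_unique\<close>). This gives uniqueness of
  \<open>(b1, b2)\<close>, and the involution property because the relation is symmetric. Applied to cubic pencils
  it also gives the braid relation: both sides of it preserve \<open>(t - a1) (t - a2) (t - a3)\<close> and put the
  three spectra in reverse order (\<open>triple_refactorization_unique\<close>, \<open>braid\<close>).

  \<^emph>\<open>Existence.\<close> If \<open>a2 \<Lambda> - \<Lambda> a1 = 1\<close> with \<open>\<Lambda>\<close> invertible, then \<open>a1 + \<Lambda>\<inverse> = \<Lambda>\<inverse> a2 \<Lambda>\<close> and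
  \<open>a2 - \<Lambda>\<inverse> = \<Lambda> a1 \<Lambda>\<inverse>\<close>, and these two matrices solve the problem (\<open>refactorization_from_sylvester\<close>).
  By Cramer's rule \<open>\<Lambda>\<close> is a rational function of \<open>(a1, a2)\<close>.

  \<^emph>\<open>Genericity.\<close> All conditions used are nonvanishing conditions on rational functions: \<open>det \<chi>'(a) \<noteq> 0\<close>
  for the characteristic polynomial \<open>\<chi>\<close> of \<open>a = a1\<close> and of \<open>a = a2\<close>, which makes the spectra simple,
  the determinant of \<open>X \<mapsto> a2 X - X a1\<close>, which makes them disjoint, and \<open>det \<Lambda>\<close>. They hold for two
  different imaginary translates \<open>D + s \<i>\<close>, \<open>D + t \<i>\<close> of a real diagonal matrix \<open>D\<close> with distinct
  entries, and on such a pair the map is the swap. So every composition in the claim can be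
  followed at such a point, at which all maps involved are regular.
\<close>

section \<open>Matrices and eigenvectors\<close>

lemma matrix_diff_ldistrib: "A ** (B - C) = A ** B - A ** (C :: 'a::ring_1 ^ 'n ^ 'm)"
  by (vector matrix_matrix_mult_def sum_subtractf[symmetric] right_diff_distrib)

lemma matrix_diff_rdistrib: "(A - B) ** C = A ** C - (B :: 'a::ring_1 ^ 'n ^ 'm) ** C"
  by (vector matrix_matrix_mult_def sum_subtractf[symmetric] left_diff_distrib)

lemma matrix_add_rdistrib: "(A + B) ** C = A ** C + (B :: 'a::ring_1 ^ 'n ^ 'm) ** C"
  by (vector matrix_matrix_mult_def sum.distrib[symmetric] distrib_right)

lemma mat_mult_component: "(mat t ** A) $ i $ j = t * (A $ i $ j :: 'a::comm_ring_1)"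
  by (simp add: matrix_matrix_mult_def mat_def mult_delta_left)

lemma mat_mult_commute: "mat t ** A = A ** mat (t :: 'a::comm_ring_1)"
  by (simp add: vec_eq_iff mat_mult_component)
     (simp add: matrix_matrix_mult_def mat_def mult_delta_right mult.commute)

lemma mat_mult_vec: "mat t *v v = (t :: 'a::comm_ring_1) *s v"
  by (simp add: vec_eq_iff matrix_vector_mult_def mat_def mult_delta_left)

lemma det_nonzero_iff_kernel:
  fixes A :: "'a::field ^ 'n ^ 'n"
  shows "det A \<noteq> 0 \<longleftrightarrow> (\<forall>x. A *v x = 0 \<longrightarrow> x = 0)"
  by (metis invertible_det_nz invertible_left_inverse matrix_left_invertible_ker)

lemma eigenvalues_iff_det: "t \<in> eigenvalues a \<longleftrightarrow> det (mat t - a) = 0"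
proof -
  have "(mat t - a) *v v = 0 \<longleftrightarrow> a *v v = t *s v" for v
    by (auto simp: matrix_vector_mult_diff_rdistrib mat_mult_vec)
  then show ?thesis
    using det_nonzero_iff_kernel[of "mat t - a"] by (auto simp: eigenvalues_def)
qed

lemma eigenvalues_similar:
  fixes M L a :: "complex ^ 'm ^ 'm"
  assumes "M ** L = mat 1"
  shows "eigenvalues (M ** a ** L) = eigenvalues a"
proof -
  have "mat t - M ** a ** L = M ** (mat t - a) ** L" for t
    using assms
    by (simp add: matrix_diff_ldistrib matrix_diff_rdistrib mat_mult_commute[symmetric])
       (simp add: matrix_mul_assoc[symmetric])
  moreover have "det M * det L = 1"
    using assms by (metis det_I det_mul)
  ultimately have "det (mat t - M ** a ** L) = det (mat t - a)" for t
    by (simp add: det_mul)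
  then show ?thesis by (auto simp: eigenvalues_iff_det)
qed

text \<open>
  Applying \<open>a - \<mu>\<close> to a linear relation kills the term with eigenvalue \<open>\<mu>\<close> and rescales the
  others by nonzero factors.
\<close>

lemma eigenvectors_independent:
  fixes v :: "complex \<Rightarrow> complex ^ 'm"
  assumes "finite S" and "\<And>l. l \<in> S \<Longrightarrow> v l \<noteq> 0" and "\<And>l. l \<in> S \<Longrightarrow> a *v v l = l *s v l"
    and "(\<Sum>l\<in>S. u l *s v l) = 0"
  shows "\<forall>l\<in>S. u l = 0"
  using assms
proof (induction S arbitrary: u rule: finite_induct)
  case (insert \<mu> S)
  have rel: "u \<mu> *s v \<mu> + (\<Sum>l\<in>S. u l *s v l) = 0"
    using insert by simp
  have "a *v (\<Sum>l\<in>S. u l *s v l) = (\<Sum>l\<in>S. (u l * l) *s v l)"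
    using insert.prems(2) by (simp add: linear_sum[OF matrix_vector_mul_linear] vector_scalar_commute)
  moreover have "a *v (u \<mu> *s v \<mu>) = (u \<mu> * \<mu>) *s v \<mu>"
    using insert.prems(2) by (simp add: vector_scalar_commute)
  ultimately have 1: "(u \<mu> * \<mu>) *s v \<mu> + (\<Sum>l\<in>S. (u l * l) *s v l) = 0"
    using arg_cong[OF rel, of "(*v) a"] by (simp add: matrix_vector_right_distrib)
  have 2: "(u \<mu> * \<mu>) *s v \<mu> + (\<Sum>l\<in>S. (u l * \<mu>) *s v l) = 0"
    using arg_cong[OF rel, of "(*s) \<mu>"]
    by (simp add: vec.scale_sum_right vec.scale_right_distrib mult.commute)
  have "(\<Sum>l\<in>S. (u l * (l - \<mu>)) *s v l) = 0"
    using arg_cong2[OF 1 2, of "(-)"]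
    by (simp add: sum_subtractf[symmetric] vec.scale_left_diff_distrib right_diff_distrib)
  then have "\<forall>l\<in>S. u l * (l - \<mu>) = 0"
    using insert.IH[of "\<lambda>l. u l * (l - \<mu>)"] insert.prems by simp
  then have *: "\<forall>l\<in>S. u l = 0"
    using insert.hyps by auto
  then show ?case using rel insert.prems(1)[of \<mu>] by simp
qed simp

text \<open>
  Eigenvectors for \<open>m\<close> distinct eigenvalues are the columns of an invertible matrix \<open>P\<close>, and
  \<open>d P = c P\<close> by hypothesis.
\<close>

lemma matrix_eq_by_eigenvectors:
  fixes c d :: "complex ^ 'm ^ 'm"
  assumes card: "card (eigenvalues c) = CARD('m)"
    and eig: "\<And>t v. c *v v = t *s v \<Longrightarrow> t \<in> eigenvalues c \<Longrightarrow> d *v v = t *s v"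
  shows "d = c"
proof -
  have "finite (eigenvalues c)" using card by (metis card.infinite zero_less_card_finite less_irrefl)
  then obtain f where f: "bij_betw f (UNIV :: 'm set) (eigenvalues c)"
    using card by (metis finite_same_card_bij finite)
  have "\<forall>l\<in>eigenvalues c. \<exists>v. v \<noteq> 0 \<and> c *v v = l *s v"
    by (simp add: eigenvalues_def)
  then obtain v where v: "\<And>l. l \<in> eigenvalues c \<Longrightarrow> v l \<noteq> 0 \<and> c *v v l = l *s v l"
    by metis
  define P :: "complex ^ 'm ^ 'm" where "P = (\<chi> i j. v (f j) $ i)"
  have Pmult: "P *v x = (\<Sum>j\<in>UNIV. x $ j *s v (f j))" for x
    by (simp add: P_def vec_eq_iff matrix_vector_mult_def mult.commute)
  have "x = 0" if "P *v x = 0" for x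
  proof -
    define g where "g = the_inv_into UNIV f"
    have gf: "g (f j) = j" for j
      using f by (simp add: g_def bij_betw_def the_inv_into_f_f)
    have "(\<Sum>l\<in>eigenvalues c. x $ g l *s v l) = (\<Sum>j\<in>UNIV. x $ g (f j) *s v (f j))"
      by (rule sum.reindex_bij_betw[OF f, symmetric])
    also have "\<dots> = 0" using that by (simp add: gf Pmult)
    finally have "\<forall>l\<in>eigenvalues c. x $ g l = 0"
      using eigenvectors_independent[of "eigenvalues c" v c "\<lambda>l. x $ g l"] v
        \<open>finite (eigenvalues c)\<close> by blast
    moreover have "f j \<in> eigenvalues c" for j using f by (auto simp: bij_betw_def)
    ultimately show ?thesis by (metis gf vec_eq_iff zero_index)
  qed
  then have "invertible P" using det_nonzero_iff_kernel invertible_det_nz by blast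
  then obtain Q where Q: "P ** Q = mat 1" by (auto simp: invertible_def)
  have "c *v (P *v x) = d *v (P *v x)" for x
  proof -
    have "c *v v (f j) = d *v v (f j)" for j
      using v eig f by (metis UNIV_I bij_betw_apply)
    then show ?thesis
      by (simp add: Pmult linear_sum[OF matrix_vector_mul_linear] vector_scalar_commute)
  qed
  then have "c ** P = d ** P" by (simp add: matrix_eq matrix_vector_mul_assoc)
  then show ?thesis by (metis Q matrix_mul_assoc matrix_mul_rid)
qed

section \<open>Uniqueness of factorizations with prescribed spectra\<close>

text \<open>
  For an eigenvalue \<open>t\<close> of the last factor \<open>t - c\<close>, the kernel of that factor lies in the kernel
  of the whole product, and hence in the kernel of any other last factor \<open>t - d\<close> preceded by an
  invertible matrix.
\<close>

lemma last_factor_unique: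
  fixes c d :: "complex ^ 'm ^ 'm"
  assumes "card (eigenvalues c) = CARD('m)"
    and eq: "\<And>t. t \<in> eigenvalues c \<Longrightarrow> P t ** (mat t - c) = Q t ** (mat t - d)"
    and inv: "\<And>t. t \<in> eigenvalues c \<Longrightarrow> det (Q t) \<noteq> 0"
  shows "d = c"
proof (rule matrix_eq_by_eigenvectors[OF assms(1)])
  fix t v assume v: "c *v v = t *s v" and t: "t \<in> eigenvalues c"
  have "(mat t - c) *v v = 0"
    by (simp add: matrix_vector_mult_diff_rdistrib mat_mult_vec v)
  then have "Q t *v ((mat t - d) *v v) = 0"
    by (metis eq[OF t] matrix_vector_mul_assoc matrix_vector_mult_0_right)
  then have "(mat t - d) *v v = 0"
    using inv[OF t] det_nonzero_iff_kernel by blast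
  then show "d *v v = t *s v"
    by (simp add: matrix_vector_mult_diff_rdistrib mat_mult_vec)
qed

lemma pencil_product:
  fixes b1 b2 :: "complex ^ 'm ^ 'm"
  shows "(mat t - b1) ** (mat t - b2) = mat t ** mat t - mat t ** (b1 + b2) + b1 ** b2"
  by (simp add: matrix_diff_ldistrib matrix_diff_rdistrib matrix_add_ldistrib
      mat_mult_commute[of t b1])

lemma refactorization_iff:
  "refactorization (a1, a2) (b1, b2) \<longleftrightarrow> b1 + b2 = a1 + a2 \<and> b1 ** b2 = a1 ** a2 \<and>
     eigenvalues b1 = eigenvalues a2 \<and> eigenvalues b2 = eigenvalues a1"
  by (simp add: refactorization_def)

lemma refactorization_pencil:
  assumes "refactorization (a1, a2) (b1, b2)"
  shows "(mat t - b1) ** (mat t - b2) = (mat t - a1) ** (mat t - a2)"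
  using assms by (simp add: refactorization_iff pencil_product)

lemma refactorization_sym: "refactorization a b \<Longrightarrow> refactorization b a"
  by (cases a; cases b) (auto simp: refactorization_iff)

text \<open>
  At the eigenvalues of \<open>b2\<close> the factor \<open>t - c1\<close> is invertible because the spectra are disjoint, so
  the last factors of the two factorizations of the same quadratic pencil agree.
\<close>

lemma refactorization_unique:
  fixes a1 :: "complex ^ 'm ^ 'm"
  assumes "card (eigenvalues a1) = CARD('m)" "eigenvalues a1 \<inter> eigenvalues a2 = {}"
    and b: "refactorization (a1, a2) b" and c: "refactorization (a1, a2) c"
  shows "b = c"
proof -
  obtain b1 b2 c1 c2 where [simp]: "b = (b1, b2)" "c = (c1, c2)"
    by (cases b; cases c)
  have "c2 = b2"
  proof (rule last_factor_unique)
    show "card (eigenvalues b2) = CARD('m)"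
      using assms by (simp add: refactorization_iff)
    show "(mat t - b1) ** (mat t - b2) = (mat t - c1) ** (mat t - c2)" for t
      using b c by (simp add: refactorization_pencil)
    show "det (mat t - c1) \<noteq> 0" if "t \<in> eigenvalues b2" for t
      using that assms unfolding eigenvalues_iff_det[symmetric]
      by (auto simp: refactorization_iff)
  qed
  moreover have "b1 + b2 = c1 + c2" using b c by (simp add: refactorization_iff)
  ultimately show ?thesis by simp
qed

text \<open>
  The equation for \<open>\<Lambda>\<close> says that \<open>a1 + \<Lambda>\<inverse>\<close> is conjugate to \<open>a2\<close>, and \<open>a2 - \<Lambda>\<inverse>\<close> to \<open>a1\<close>,
  both by \<open>\<Lambda>\<close>; multiplied by \<open>\<Lambda>\<inverse>\<close> on both sides it becomes the equation of products.
\<close>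

lemma refactorization_from_sylvester:
  assumes eq: "a2 ** L - L ** a1 = mat 1" and inv: "invertible L"
  shows "refactorization (a1, a2) (a1 + matrix_inv L, a2 - matrix_inv L)"
proof -
  define M where "M = matrix_inv L"
  have "L ** M = mat 1 \<and> M ** L = mat 1"
    unfolding M_def matrix_inv_def
    by (rule someI_ex) (use inv in \<open>auto simp: invertible_def\<close>)
  then have LM1: "L ** M = mat 1" and ML1: "M ** L = mat 1"
    by auto
  have "M ** (a2 ** L - L ** a1) = M" using eq by simp
  then have "M ** a2 ** L - a1 = M"
    by (simp add: matrix_diff_ldistrib matrix_mul_assoc ML1)
  then have b1: "a1 + M = M ** a2 ** L" by (simp add: algebra_simps)
  have "(a2 ** L - L ** a1) ** M = M" using eq by simp
  then have "a2 - L ** a1 ** M = M"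
    by (simp add: matrix_diff_rdistrib matrix_mul_assoc[symmetric] LM1)
  then have b2: "a2 - M = L ** a1 ** M" by (simp add: algebra_simps)
  have "M ** a2 - a1 ** M = (M ** a2 ** L - a1) ** M"
    by (simp add: matrix_diff_rdistrib matrix_mul_assoc[symmetric] LM1)
  also have "\<dots> = M ** M" by (simp add: \<open>M ** a2 ** L - a1 = M\<close>)
  finally have "(a1 + M) ** (a2 - M) = a1 ** a2"
    by (simp add: matrix_diff_ldistrib matrix_add_rdistrib algebra_simps)
  moreover have "eigenvalues (a1 + M) = eigenvalues a2" "eigenvalues (a2 - M) = eigenvalues a1"
    unfolding b1 b2 using LM1 ML1 by (simp_all add: eigenvalues_similar)
  ultimately show ?thesis by (simp add: refactorization_iff M_def)
qed

text \<open>
  The analogue for cubic pencils. The last factors agree by comparison of kernels. The middle ones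
  only have to be compared at the eigenvalues of \<open>c2\<close>, where the common last factor is invertible
  and can be cancelled; the equation of sums then settles the first.
\<close>

lemma triple_refactorization_unique:
  fixes c1 c2 c3 d1 d2 d3 :: "complex ^ 'm ^ 'm"
  assumes sum: "c1 + c2 + c3 = d1 + d2 + d3"
    and cubic: "\<And>t. (mat t - c1) ** (mat t - c2) ** (mat t - c3)
                   = (mat t - d1) ** (mat t - d2) ** (mat t - d3)"
    and spectra: "eigenvalues d1 = eigenvalues c1" "eigenvalues d2 = eigenvalues c2"
      "eigenvalues d3 = eigenvalues c3"
    and card: "card (eigenvalues c2) = CARD('m)" "card (eigenvalues c3) = CARD('m)"
    and disj: "eigenvalues c1 \<inter> eigenvalues c2 = {}" "eigenvalues c1 \<inter> eigenvalues c3 = {}"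
      "eigenvalues c2 \<inter> eigenvalues c3 = {}"
  shows "(c1, c2, c3) = (d1, d2, d3)"
proof -
  have nz: "det (mat t - c) \<noteq> 0 \<longleftrightarrow> t \<notin> eigenvalues c" for t and c :: "complex ^ 'm ^ 'm"
    by (simp add: eigenvalues_iff_det)
  have 3: "d3 = c3"
  proof (rule last_factor_unique[OF card(2) cubic])
    show "det ((mat t - d1) ** (mat t - d2)) \<noteq> 0" if "t \<in> eigenvalues c3" for t
      using that spectra disj unfolding det_mul mult_eq_0_iff de_Morgan_disj nz by auto
  qed
  have 2: "d2 = c2"
  proof (rule last_factor_unique[OF card(1)])
    fix t assume t: "t \<in> eigenvalues c2"
    then have "det (mat t - c3) \<noteq> 0" "det (mat t - d1) \<noteq> 0"
      using spectra disj unfolding nz by auto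
    then show "det (mat t - d1) \<noteq> 0" by simp
    obtain N where "(mat t - c3) ** N = mat 1"
      using \<open>det (mat t - c3) \<noteq> 0\<close> invertible_det_nz invertible_right_inverse by blast
    then show "(mat t - c1) ** (mat t - c2) = (mat t - d1) ** (mat t - d2)"
      using cubic[of t] unfolding 3 by (metis matrix_mul_assoc matrix_mul_rid)
  qed
  show ?thesis using sum 2 3 by simp
qed

section \<open>A polynomial condition for distinct eigenvalues\<close>

definition charpoly :: "complex ^ 'm ^ 'm \<Rightarrow> complex poly" where
  "charpoly a = det (\<chi> i j. [:- (a $ i $ j), if i = j then 1 else 0:])"

lemma poly_det: "poly (det A) t = det (\<chi> i j. poly (A $ i $ j) (t :: complex))"
  by (simp add: det_def poly_sum poly_prod)

lemma poly_charpoly: "poly (charpoly a) t = det (mat t - a)"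
  unfolding charpoly_def poly_det
  by (rule arg_cong[where f = det]) (simp add: vec_eq_iff mat_def)

lemma eigenvalues_roots: "eigenvalues a = {t. poly (charpoly a) t = 0}"
  by (auto simp: eigenvalues_iff_det poly_charpoly)

lemma prod_linear_poly:
  fixes u v :: "'i \<Rightarrow> complex"
  assumes "finite S"
  shows "degree (\<Prod>i\<in>S. [:u i, v i:]) \<le> card S \<and> coeff (\<Prod>i\<in>S. [:u i, v i:]) (card S) = (\<Prod>i\<in>S. v i)"
  using assms
proof (induction S rule: finite_induct)
  case (insert x S)
  let ?p = "\<Prod>i\<in>S. [:u i, v i:]"
  have "degree ([:u x, v x:] * ?p) \<le> degree [:u x, v x:] + degree ?p"
    by (rule degree_mult_le)
  also have "\<dots> \<le> 1 + card S"
    using insert.IH by (intro add_mono) auto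
  finally have "degree ([:u x, v x:] * ?p) \<le> Suc (card S)" by simp
  moreover have "coeff ?p (Suc (card S)) = 0"
    using insert.IH by (intro coeff_eq_0) auto
  ultimately show ?case using insert by simp
qed simp

text \<open>
  The coefficient of degree \<open>m\<close> of a determinant of linear polynomials is the determinant of the
  leading coefficients, here of the identity matrix.
\<close>

lemma charpoly_degree:
  fixes a :: "complex ^ 'm ^ 'm"
  shows "degree (charpoly a) = CARD('m)" "coeff (charpoly a) CARD('m) = 1"
proof -
  let ?t = "\<lambda>p. of_int (sign p) * (\<Prod>i\<in>UNIV. [:- (a $ i $ p i), if i = p i then 1 else 0:]) :: complex poly"
  have cp: "charpoly a = (\<Sum>p | p permutes UNIV. ?t p)"
    by (simp add: charpoly_def det_def)
  have deg: "degree (?t p) \<le> CARD('m)" for p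
    using prod_linear_poly[of "UNIV :: 'm set" "\<lambda>i. - (a $ i $ p i)" "\<lambda>i. if i = p i then 1 else 0"]
    by (auto simp: of_int_poly intro: order.trans[OF degree_smult_le])
  then have le: "degree (charpoly a) \<le> CARD('m)"
    unfolding cp by (intro degree_sum_le) auto
  have "coeff (charpoly a) CARD('m)
      = (\<Sum>p | p permutes UNIV. of_int (sign p) * (\<Prod>i\<in>(UNIV :: 'm set). if i = p i then 1 else 0))"
    unfolding cp coeff_sum
  proof (rule sum.cong[OF refl])
    fix p :: "'m \<Rightarrow> 'm"
    show "coeff (?t p) CARD('m) = of_int (sign p) * (\<Prod>i\<in>UNIV. if i = p i then 1 else 0)"
      using prod_linear_poly[of "UNIV :: 'm set" "\<lambda>i. - (a $ i $ p i)" "\<lambda>i. if i = p i then 1 else 0"]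
      by (simp add: of_int_poly)
  qed
  also have "\<dots> = det (mat 1 :: complex ^ 'm ^ 'm)"
    by (simp add: det_def mat_def)
  finally show 1: "coeff (charpoly a) CARD('m) = 1" by simp
  then show "degree (charpoly a) = CARD('m)"
    using le le_degree[of "charpoly a" "CARD('m)"] by simp
qed

lemma charpoly_nonzero: "charpoly a \<noteq> 0"
  using charpoly_degree(2)[of a] by auto

lemma card_roots_rsquarefree:
  assumes "rsquarefree (p :: complex poly)"
  shows "card {z. poly p z = 0} = degree p"
proof -
  have "p \<noteq> 0" using assms by (simp add: rsquarefree_def)
  have "degree p = degree (\<Prod>z | poly p z = 0. [:- z, 1:])"
    using complex_poly_decompose_rsquarefree[OF assms] \<open>p \<noteq> 0\<close>
    by (metis degree_smult_eq leading_coeff_neq_0)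
  also have "\<dots> = card {z. poly p z = 0}"
    by (subst degree_prod_sum_eq) auto
  finally show ?thesis by simp
qed

text \<open>A double root could be divided out without losing a root, while lowering the degree.\<close>

lemma simple_roots_if_card:
  assumes "card {z. poly p z = 0} = degree p" "p \<noteq> 0" "poly p z = (0 :: complex)"
  shows "poly (pderiv p) z \<noteq> 0"
proof
  assume d: "poly (pderiv p) z = 0"
  obtain q where q: "p = [:- z, 1:] * q"
    using assms(3) by (meson poly_eq_0_iff_dvd dvd_def)
  then have "q \<noteq> 0" using assms(2) by auto
  have "pderiv p = [:- z, 1:] * pderiv q + q"
    unfolding q pderiv_mult by (simp add: pderiv_pCons)
  then have "poly q z = 0" using d by simp
  then have "{x. poly p x = 0} = {x. poly q x = 0}"
    by (auto simp: q)
  moreover have "degree p = Suc (degree q)"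
    using degree_mult_eq[of "[:- z, 1:]" q] \<open>q \<noteq> 0\<close> q by simp
  moreover have "card {x. poly q x = 0} \<le> degree q"
    using card_poly_roots_bound[OF \<open>q \<noteq> 0\<close>] by simp
  ultimately show False using assms(1) by simp
qed

definition matpow :: "complex ^ 'm ^ 'm \<Rightarrow> nat \<Rightarrow> complex ^ 'm ^ 'm" where
  "matpow a k = ((**) a ^^ k) (mat 1)"

text \<open>
  The range of summation does not depend on \<open>p\<close>, so that the entries are polynomials in the
  coefficients of \<open>p\<close> and the entries of \<open>a\<close>.
\<close>

definition matrix_poly :: "complex poly \<Rightarrow> complex ^ 'm ^ 'm \<Rightarrow> complex ^ 'm ^ 'm" where
  "matrix_poly p a = (\<Sum>k\<le>CARD('m). mat (coeff p k) ** matpow a k)"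

text \<open>Up to sign this is the discriminant of the characteristic polynomial of \<open>a\<close>.\<close>

definition disc :: "complex ^ 'm ^ 'm \<Rightarrow> complex" where
  "disc a = det (matrix_poly (pderiv (charpoly a)) a)"

lemma poly_as_bounded_sum: "degree p \<le> n \<Longrightarrow> poly p (t :: complex) = (\<Sum>k\<le>n. coeff p k * t ^ k)"
  unfolding poly_altdef by (intro sum.mono_neutral_left) (auto simp: coeff_eq_0)

lemma matpow_eigenvector: "a *v v = t *s v \<Longrightarrow> matpow a k *v v = t ^ k *s v"
proof (induction k)
  case (Suc k)
  have "matpow a (Suc k) *v v = a *v (matpow a k *v v)"
    by (simp add: matpow_def matrix_vector_mul_assoc)
  then show ?case using Suc by (simp add: vector_scalar_commute mult.commute)
qed (simp add: matpow_def)

lemma sum_matrix_vector: "(\<Sum>k\<in>S. A k) *v v = (\<Sum>k\<in>S. A k *v (v :: complex ^ 'm))"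
  by (induction S rule: infinite_finite_induct) (simp_all add: matrix_vector_mult_add_rdistrib)

lemma matrix_poly_eigenvector:
  fixes a :: "complex ^ 'm ^ 'm"
  assumes "a *v v = t *s v" "degree p \<le> CARD('m)"
  shows "matrix_poly p a *v v = poly p t *s v"
  using assms(2)
  by (simp add: matrix_poly_def sum_matrix_vector matrix_vector_mul_assoc[symmetric] mat_mult_vec
      matpow_eigenvector[OF assms(1)] poly_as_bounded_sum vec.scale_sum_left vector_smult_assoc)

text \<open>
  A common root \<open>t\<close> of \<open>\<chi>\<close> and \<open>\<chi>'\<close> is an eigenvalue of \<open>a\<close>, and its eigenvectors are killed by
  \<open>\<chi>'(a)\<close>.
\<close>

lemma card_eigenvalues_if_disc:
  fixes a :: "complex ^ 'm ^ 'm"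
  assumes "disc a \<noteq> 0"
  shows "card (eigenvalues a) = CARD('m)"
proof -
  have "rsquarefree (charpoly a)"
    unfolding rsquarefree_roots
  proof safe
    fix t assume t: "poly (charpoly a) t = 0" "poly (pderiv (charpoly a)) t = 0"
    then obtain v where v: "v \<noteq> 0" "a *v v = t *s v"
      using eigenvalues_roots[of a] by (auto simp: eigenvalues_def)
    have "degree (pderiv (charpoly a)) \<le> CARD('m)"
      by (simp add: degree_pderiv charpoly_degree)
    then have "matrix_poly (pderiv (charpoly a)) a *v v = 0"
      using v t by (simp add: matrix_poly_eigenvector)
    then show False using v assms det_nonzero_iff_kernel unfolding disc_def by blast
  qed
  then show ?thesis
    by (simp add: eigenvalues_roots card_roots_rsquarefree charpoly_degree)
qed

definition diag :: "('m \<Rightarrow> complex) \<Rightarrow> complex ^ 'm ^ 'm" where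
  "diag d = (\<chi> i j. if i = j then d i else 0)"

lemma diag_axis: "diag d *v axis i 1 = d i *s axis i 1"
  by (simp add: vec_eq_iff matrix_vector_mult_def diag_def axis_def mult_delta_left)

text \<open>
  The diagonal entries exhaust the roots of the characteristic polynomial \<open>\<chi>\<close>, so its roots are
  simple, and \<open>\<chi>'\<close> of the diagonal matrix is diagonal with nonzero entries.
\<close>

lemma disc_diag:
  fixes d :: "'m::finite \<Rightarrow> complex"
  assumes "inj d"
  shows "disc (diag d) \<noteq> 0"
proof -
  let ?p = "charpoly (diag d)"
  have root: "poly ?p (d i) = 0" for i
  proof -
    have "d i \<in> eigenvalues (diag d)"
      unfolding eigenvalues_def mem_Collect_eq
      by (rule exI[of _ "axis i 1"]) (simp add: diag_axis axis_eq_0_iff)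
    then show ?thesis by (simp add: eigenvalues_roots)
  qed
  have "card {z. poly ?p z = 0} \<ge> card (range d)"
    using root by (intro card_mono poly_roots_finite charpoly_nonzero) auto
  then have "card {z. poly ?p z = 0} = degree ?p"
    using card_poly_roots_bound[OF charpoly_nonzero, of "diag d"] assms
    by (simp add: card_image charpoly_degree)
  then have simple: "poly (pderiv ?p) (d i) \<noteq> 0" for i
    using simple_roots_if_card charpoly_nonzero root by blast
  let ?M = "matrix_poly (pderiv ?p) (diag d)"
  have col: "?M *v axis j 1 = poly (pderiv ?p) (d j) *s axis j 1" for j
    by (intro matrix_poly_eigenvector diag_axis) (simp add: degree_pderiv charpoly_degree)
  have "?M $ i $ j = (if i = j then poly (pderiv ?p) (d i) else 0)" for i j
  proof -
    have "?M $ i $ j = (?M *v axis j 1) $ i"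
      by (simp add: matrix_vector_mult_def axis_def mult_delta_right)
    then show ?thesis unfolding col by (simp add: axis_def)
  qed
  then have "disc (diag d) = (\<Prod>i\<in>UNIV. poly (pderiv ?p) (d i))"
    unfolding disc_def by (subst det_diagonal) auto
  then show ?thesis using simple by simp
qed

section \<open>The linear equation for \<open>\<Lambda>\<close>\<close>

text \<open>
  The matrix of \<open>X \<mapsto> a2 X - X a1\<close> on matrices written as vectors indexed by pairs.
\<close>

definition sylvester :: "complex ^ 'm ^ 'm \<Rightarrow> complex ^ 'm ^ 'm \<Rightarrow> complex ^ ('m \<times> 'm) ^ ('m \<times> 'm)" where
  "sylvester a1 a2 = (\<chi> p q. (if snd p = snd q then a2 $ fst p $ fst q else 0)
                           - (if fst p = fst q then a1 $ snd q $ snd p else 0))"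

definition flatten :: "complex ^ 'm ^ 'm \<Rightarrow> complex ^ ('m \<times> 'm)" where
  "flatten X = (\<chi> p. X $ fst p $ snd p)"

lemma flatten_eq_iff [simp]: "flatten X = flatten Y \<longleftrightarrow> X = Y"
  by (simp add: flatten_def vec_eq_iff)

lemma sylvester_flatten: "sylvester a1 a2 *v flatten X = flatten (a2 ** X - X ** a1)"
proof -
  have "(\<Sum>q\<in>UNIV. (if j = snd q then a2 $ i $ fst q else 0) * X $ fst q $ snd q)
      = (\<Sum>k\<in>UNIV. a2 $ i $ k * X $ k $ j)"
    "(\<Sum>q\<in>UNIV. (if i = fst q then a1 $ snd q $ j else 0) * X $ fst q $ snd q)
      = (\<Sum>k\<in>UNIV. X $ i $ k * a1 $ k $ j)" for i j
    unfolding UNIV_Times_UNIV[symmetric] sum.cartesian_product'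
     by (simp_all add: mult_delta_left mult.commute[of "X $ _ $ _"] sum.delta')
        (subst sum.swap, simp add: mult_delta_left)+
  then show ?thesis
    by (simp add: vec_eq_iff sylvester_def flatten_def matrix_vector_mult_def
        matrix_matrix_mult_def left_diff_distrib sum_subtractf)
qed

text \<open>Cramer's rule exhibits the solution as a rational function of \<open>(a1, a2)\<close>.\<close>

definition sylvester_solution :: "complex ^ 'm ^ 'm \<Rightarrow> complex ^ 'm ^ 'm \<Rightarrow> complex ^ 'm ^ 'm" where
  "sylvester_solution a1 a2 = (\<chi> i j.
     det (\<chi> p q. if q = (i, j) then flatten (mat 1) $ p else sylvester a1 a2 $ p $ q)
       / det (sylvester a1 a2))"

lemma sylvester_solution_iff:
  assumes "det (sylvester a1 a2) \<noteq> 0"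
  shows "a2 ** X - X ** a1 = mat 1 \<longleftrightarrow> X = sylvester_solution a1 a2"
proof -
  have "a2 ** X - X ** a1 = mat 1 \<longleftrightarrow> sylvester a1 a2 *v flatten X = flatten (mat 1)"
    by (simp add: sylvester_flatten)
  also have "\<dots> \<longleftrightarrow> flatten X = flatten (sylvester_solution a1 a2)"
    unfolding cramer[OF assms] by (simp add: flatten_def sylvester_solution_def)
  finally show ?thesis by simp
qed

text \<open>
  For a common eigenvalue, the product of an eigenvector of \<open>a2\<close> with a left eigenvector of \<open>a1\<close>
  is a matrix of rank one in the kernel of \<open>X \<mapsto> a2 X - X a1\<close>.
\<close>

lemma eigenvalues_disjoint_if_sylvester:
  assumes "det (sylvester a1 a2) \<noteq> 0"
  shows "eigenvalues a1 \<inter> eigenvalues a2 = {}"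
proof safe
  fix t assume "t \<in> eigenvalues a1" "t \<in> eigenvalues a2"
  have "mat t - transpose a1 = transpose (mat t - a1)"
    by (simp add: vec_eq_iff transpose_def mat_def)
  then have "t \<in> eigenvalues (transpose a1)"
    using \<open>t \<in> eigenvalues a1\<close> by (simp add: eigenvalues_iff_det)
  then obtain u v where u: "u \<noteq> 0" "transpose a1 *v u = t *s u" and v: "v \<noteq> 0" "a2 *v v = t *s v"
    using \<open>t \<in> eigenvalues a2\<close> by (auto simp: eigenvalues_def)
  define X where "X = (\<chi> i j. v $ i * u $ j)"
  have "a2 ** X = (\<chi> i j. (a2 *v v) $ i * u $ j)"
    by (simp add: vec_eq_iff X_def matrix_matrix_mult_def matrix_vector_mult_def
        sum_distrib_right mult.assoc)
  moreover have "X ** a1 = (\<chi> i j. v $ i * (transpose a1 *v u) $ j)"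
    by (simp add: vec_eq_iff X_def matrix_matrix_mult_def matrix_vector_mult_def
        sum_distrib_left transpose_def mult_ac)
  ultimately have "a2 ** X - X ** a1 = 0"
    unfolding u v by (simp add: vec_eq_iff)
  then have "sylvester a1 a2 *v flatten X = 0"
    by (simp add: sylvester_flatten) (simp add: flatten_def vec_eq_iff)
  then have "flatten X = 0"
    using assms det_nonzero_iff_kernel by blast
  then have "flatten X $ (i, j) = 0" for i j
    by (simp only: zero_index)
  then have "v $ i * u $ j = 0" for i j
    by (simp add: flatten_def X_def)
  then show "t \<in> {}" using u(1) v(1) by (auto simp: vec_eq_iff)
qed

text \<open>Cramer's rule again, for the regularity of \<open>\<Lambda>\<inverse>\<close>.\<close>

lemma matrix_inv_cramer:
  fixes A :: "complex ^ 'm ^ 'm"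
  assumes "det A \<noteq> 0"
  shows "matrix_inv A $ i $ j = det (\<chi> k l. if l = i then axis j 1 $ k else A $ k $ l) / det A"
proof -
  have "invertible A" using assms by (simp add: invertible_det_nz)
  then have "\<exists>B. A ** B = mat 1 \<and> B ** A = mat 1" by (auto simp: invertible_def)
  then have "A ** matrix_inv A = mat 1"
    unfolding matrix_inv_def by (rule someI2_ex) simp
  then have "A *v (matrix_inv A *v axis j 1) = axis j 1"
    by (simp add: matrix_vector_mul_assoc)
  then have "(matrix_inv A *v axis j 1) $ i
      = det (\<chi> k l. if l = i then axis j 1 $ k else A $ k $ l) / det A"
    using cramer[OF assms, of "matrix_inv A *v axis j 1" "axis j 1"] by (simp add: vec_eq_iff)
  moreover have "(matrix_inv A *v axis j 1) $ i = matrix_inv A $ i $ j"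
    by (simp add: matrix_vector_mult_def axis_def mult_delta_right)
  ultimately show ?thesis by simp
qed

section \<open>Zariski neighbourhoods of a point\<close>

text \<open>
  A property that holds on a principal Zariski-open neighbourhood of some point holds generically,
  and such neighbourhoods are stable under intersection and under preimages by maps regular at the
  point. Keeping track of one point thus replaces all arguments about proper closed subsets and
  dominant maps.
\<close>

definition near :: "'a::complex_affine \<Rightarrow> ('a \<Rightarrow> bool) \<Rightarrow> bool" where
  "near w Q \<longleftrightarrow> (\<exists>q. polynomial_fun q \<and> q w \<noteq> 0 \<and> (\<forall>x. q x \<noteq> 0 \<longrightarrow> Q x))"

definition regular_at :: "'a::complex_affine \<Rightarrow> ('a \<Rightarrow> complex) \<Rightarrow> bool" where
  "regular_at w h \<longleftrightarrow>
     (\<exists>p q. polynomial_fun p \<and> polynomial_fun q \<and> q w \<noteq> 0 \<and> (\<forall>x. q x \<noteq> 0 \<longrightarrow> h x = p x / q x))"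

definition regular_map_at :: "'a::complex_affine \<Rightarrow> ('a \<Rightarrow> 'b::complex_affine) \<Rightarrow> bool" where
  "regular_map_at w f \<longleftrightarrow> (\<forall>c\<in>coords. regular_at w (\<lambda>x. c (f x)))"

lemma near_conj:
  assumes "near w P" "near w Q"
  shows "near w (\<lambda>x. P x \<and> Q x)"
proof -
  obtain p q where "polynomial_fun p" "p w \<noteq> 0" "\<And>x. p x \<noteq> 0 \<Longrightarrow> P x"
    "polynomial_fun q" "q w \<noteq> 0" "\<And>x. q x \<noteq> 0 \<Longrightarrow> Q x"
    using assms unfolding near_def by metis
  then show ?thesis
    unfolding near_def by (intro exI[of _ "\<lambda>x. p x * q x"]) (auto intro: polynomial_fun.mult)
qed

lemma near_mono: "near w P \<Longrightarrow> (\<And>x. P x \<Longrightarrow> Q x) \<Longrightarrow> near w Q"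
  unfolding near_def by metis

lemma generically_if_near: "near w Q \<Longrightarrow> generically Q"
  unfolding near_def generically_def zariski_closed_def
proof (elim exE conjE)
  fix q assume "polynomial_fun q" "q w \<noteq> 0" "\<forall>x. q x \<noteq> 0 \<longrightarrow> Q x"
  then show "\<exists>Z. (\<exists>P. (\<forall>p\<in>P. polynomial_fun p) \<and> Z = {x. \<forall>p\<in>P. p x = 0}) \<and> Z \<noteq> UNIV
      \<and> (\<forall>x. x \<notin> Z \<longrightarrow> Q x)"
    by (intro exI[of _ "{x. q x = 0}"] conjI exI[of _ "{q}"]) auto
qed

lemma regular_atI:
  assumes "polynomial_fun p" "polynomial_fun q" "q w \<noteq> 0" "\<And>x. q x \<noteq> 0 \<Longrightarrow> h x = p x / q x"
  shows "regular_at w h"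
  using assms unfolding regular_at_def by blast

lemma regular_atE:
  assumes "regular_at w h"
  obtains p q where "polynomial_fun p" "polynomial_fun q" "q w \<noteq> 0"
    "\<And>x. q x \<noteq> 0 \<Longrightarrow> h x = p x / q x"
  using assms unfolding regular_at_def by blast

lemma regular_polynomial: "polynomial_fun p \<Longrightarrow> regular_at w p"
  by (rule regular_atI[of p "\<lambda>_. 1"]) (auto intro: polynomial_fun.const)

lemma regular_const [intro, simp]: "regular_at w (\<lambda>x. k)"
  by (intro regular_polynomial polynomial_fun.const)

lemma regular_add [intro]:
  assumes "regular_at w g" "regular_at w h"
  shows "regular_at w (\<lambda>x. g x + h x)"
proof -
  obtain p q where 1: "polynomial_fun p" "polynomial_fun q" "q w \<noteq> 0" "\<And>x. q x \<noteq> 0 \<Longrightarrow> g x = p x / q x"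
    using assms(1) by (rule regular_atE) blast
  obtain r s where 2: "polynomial_fun r" "polynomial_fun s" "s w \<noteq> 0" "\<And>x. s x \<noteq> 0 \<Longrightarrow> h x = r x / s x"
    using assms(2) by (rule regular_atE) blast
  show ?thesis
    by (rule regular_atI[of "\<lambda>x. p x * s x + r x * q x" "\<lambda>x. q x * s x"])
       (use 1 2 in \<open>auto intro: polynomial_fun.intros simp: field_simps\<close>)
qed

lemma regular_mult [intro]:
  assumes "regular_at w g" "regular_at w h"
  shows "regular_at w (\<lambda>x. g x * h x)"
proof -
  obtain p q where 1: "polynomial_fun p" "polynomial_fun q" "q w \<noteq> 0" "\<And>x. q x \<noteq> 0 \<Longrightarrow> g x = p x / q x"
    using assms(1) by (rule regular_atE) blast
  obtain r s where 2: "polynomial_fun r" "polynomial_fun s" "s w \<noteq> 0" "\<And>x. s x \<noteq> 0 \<Longrightarrow> h x = r x / s x"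
    using assms(2) by (rule regular_atE) blast
  show ?thesis
    by (rule regular_atI[of "\<lambda>x. p x * r x" "\<lambda>x. q x * s x"])
       (use 1 2 in \<open>auto intro: polynomial_fun.intros\<close>)
qed

lemma regular_divide:
  assumes "regular_at w g" "regular_at w h" "h w \<noteq> 0"
  shows "regular_at w (\<lambda>x. g x / h x)"
proof -
  obtain p q where 1: "polynomial_fun p" "polynomial_fun q" "q w \<noteq> 0" "\<And>x. q x \<noteq> 0 \<Longrightarrow> g x = p x / q x"
    using assms(1) by (rule regular_atE) blast
  obtain r s where 2: "polynomial_fun r" "polynomial_fun s" "s w \<noteq> 0" "\<And>x. s x \<noteq> 0 \<Longrightarrow> h x = r x / s x"
    using assms(2) by (rule regular_atE) blast
  have "r w \<noteq> 0" using 2 assms(3) by auto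
  \<comment> \<open>The extra factor \<open>s\<close> in the denominator keeps the formula for \<open>h\<close> valid where it is nonzero.\<close>
  show ?thesis
    by (rule regular_atI[of "\<lambda>x. p x * (s x * s x)" "\<lambda>x. q x * (r x * s x)"])
       (use 1 2 \<open>r w \<noteq> 0\<close> in \<open>auto intro: polynomial_fun.mult\<close>)
qed

lemma regular_uminus [intro]: "regular_at w g \<Longrightarrow> regular_at w (\<lambda>x. - g x)"
  using regular_mult[of w "\<lambda>_. - 1" g] by simp

lemma regular_diff [intro]: "regular_at w g \<Longrightarrow> regular_at w h \<Longrightarrow> regular_at w (\<lambda>x. g x - h x)"
  using regular_add[of w g "\<lambda>x. - h x"] by auto

lemma regular_sum [intro]:
  "(\<And>i. i \<in> S \<Longrightarrow> regular_at w (g i)) \<Longrightarrow> regular_at w (\<lambda>x. \<Sum>i\<in>S. g i x)"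
  by (induction S rule: infinite_finite_induct) auto

lemma regular_prod [intro]:
  "(\<And>i. i \<in> S \<Longrightarrow> regular_at w (g i)) \<Longrightarrow> regular_at w (\<lambda>x. \<Prod>i\<in>S. g i x)"
  by (induction S rule: infinite_finite_induct) auto

lemma regular_if:
  "regular_at w g \<Longrightarrow> regular_at w h \<Longrightarrow> regular_at w (\<lambda>x. if b then g x else h x)"
  by (cases b) auto

lemmas regular_intros =
  regular_const regular_add regular_mult regular_uminus regular_diff regular_sum regular_prod regular_if

lemma near_nonzero:
  assumes "regular_at w h" "h w \<noteq> 0"
  shows "near w (\<lambda>x. h x \<noteq> 0)"
proof -
  obtain p q where 1: "polynomial_fun p" "polynomial_fun q" "q w \<noteq> 0" "\<And>x. q x \<noteq> 0 \<Longrightarrow> h x = p x / q x"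
    using assms(1) by (rule regular_atE) blast
  then show ?thesis
    unfolding near_def using assms(2)
    by (intro exI[of _ "\<lambda>x. p x * q x"]) (auto intro: polynomial_fun.mult)
qed

lemma regular_at_cong:
  assumes "near w (\<lambda>x. g x = h x)" "regular_at w h"
  shows "regular_at w g"
proof -
  obtain p q where 1: "polynomial_fun p" "polynomial_fun q" "q w \<noteq> 0" "\<And>x. q x \<noteq> 0 \<Longrightarrow> h x = p x / q x"
    using assms(2) by (rule regular_atE) blast
  obtain r where 2: "polynomial_fun r" "r w \<noteq> 0" "\<And>x. r x \<noteq> 0 \<Longrightarrow> g x = h x"
    using assms(1) unfolding near_def by blast
  show ?thesis
    by (rule regular_atI[of "\<lambda>x. p x * r x" "\<lambda>x. q x * r x"])
       (use 1 2 in \<open>auto intro: polynomial_fun.mult\<close>)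
qed

lemma regular_map_at_cong:
  assumes "near w (\<lambda>x. f x = g x)" "regular_map_at w g"
  shows "regular_map_at w f"
  unfolding regular_map_at_def
proof
  fix c :: "'b \<Rightarrow> complex" assume "c \<in> coords"
  have "near w (\<lambda>x. c (f x) = c (g x))"
    using assms(1) by (rule near_mono) simp
  then show "regular_at w (\<lambda>x. c (f x))"
    by (rule regular_at_cong) (use assms(2) \<open>c \<in> coords\<close> in \<open>auto simp: regular_map_at_def\<close>)
qed

lemma regular_polynomial_compose:
  "polynomial_fun p \<Longrightarrow> regular_map_at w f \<Longrightarrow> regular_at w (\<lambda>x. p (f x))"
  by (induction rule: polynomial_fun.induct) (auto simp: regular_map_at_def)

lemma near_compose:
  assumes "regular_map_at w f" "near (f w) Q"
  shows "near w (\<lambda>x. Q (f x))"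
proof -
  obtain q where "polynomial_fun q" "q (f w) \<noteq> 0" "\<And>x. q x \<noteq> 0 \<Longrightarrow> Q x"
    using assms(2) unfolding near_def by blast
  then show ?thesis
    using near_nonzero[of w "\<lambda>x. q (f x)"] regular_polynomial_compose[OF _ assms(1)]
    by (auto intro: near_mono)
qed

lemma regular_at_compose:
  assumes "regular_map_at w f" "regular_at (f w) h"
  shows "regular_at w (\<lambda>x. h (f x))"
proof -
  obtain p q where 1: "polynomial_fun p" "polynomial_fun q" "q (f w) \<noteq> 0" "\<And>x. q x \<noteq> 0 \<Longrightarrow> h x = p x / q x"
    using assms(2) by (rule regular_atE) blast
  then have "near w (\<lambda>x. h (f x) = p (f x) / q (f x))"
    using near_nonzero[of w "\<lambda>x. q (f x)"] regular_polynomial_compose[OF _ assms(1)]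
    by (auto intro: near_mono)
  moreover have "regular_at w (\<lambda>x. p (f x) / q (f x))"
    using 1 assms(1) by (intro regular_divide regular_polynomial_compose)
  ultimately show ?thesis by (rule regular_at_cong)
qed

lemma regular_map_at_compose:
  "regular_map_at w f \<Longrightarrow> regular_map_at (f w) g \<Longrightarrow> regular_map_at w (\<lambda>x. g (f x))"
  using regular_at_compose[of w f] by (auto simp: regular_map_at_def)

lemma rational_map_if_regular: "regular_map_at w f \<Longrightarrow> rational_map f"
  unfolding rational_map_def
proof
  fix c :: "'b \<Rightarrow> complex"
  assume "regular_map_at w f" "c \<in> coords"
  then obtain p q where "polynomial_fun p" "polynomial_fun q" "q w \<noteq> 0"
    "\<And>x. q x \<noteq> 0 \<Longrightarrow> c (f x) = p x / q x"
    by (auto simp: regular_map_at_def regular_at_def)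
  then show "\<exists>p q. polynomial_fun p \<and> polynomial_fun q
      \<and> generically (\<lambda>x. q x \<noteq> 0 \<and> c (f x) = p x / q x)"
    by (intro exI[of _ p] exI[of _ q] conjI generically_if_near[of w])
       (auto simp: near_def)
qed

lemma regular_map_at_id: "regular_map_at w (\<lambda>x. x)"
  by (auto simp: regular_map_at_def intro: regular_polynomial polynomial_fun.coord)

lemma regular_map_at_Pair:
  "regular_map_at w f \<Longrightarrow> regular_map_at w g \<Longrightarrow> regular_map_at w (\<lambda>x. (f x, g x))"
  by (auto simp: regular_map_at_def coords_prod_def)

lemma regular_map_at_fst: "regular_map_at w f \<Longrightarrow> regular_map_at w (\<lambda>x. fst (f x))"
  by (auto simp: regular_map_at_def coords_prod_def)

lemma regular_map_at_snd: "regular_map_at w f \<Longrightarrow> regular_map_at w (\<lambda>x. snd (f x))"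
  by (auto simp: regular_map_at_def coords_prod_def)

section \<open>Regularity of matrix expressions\<close>

lemma regular_map_at_matrix:
  "regular_map_at w (f :: 'a::complex_affine \<Rightarrow> complex ^ 'n ^ 'm)
    \<longleftrightarrow> (\<forall>i j. regular_at w (\<lambda>x. f x $ i $ j))"
  by (auto simp: regular_map_at_def coords_vec_def coords_complex_def)

lemma regular_matrix_mult:
  fixes f g :: "'a::complex_affine \<Rightarrow> complex ^ 'n ^ 'n"
  shows "regular_map_at w f \<Longrightarrow> regular_map_at w g \<Longrightarrow> regular_map_at w (\<lambda>x. f x ** g x)"
  unfolding regular_map_at_matrix by (auto simp: matrix_matrix_mult_def intro!: regular_intros)

lemma regular_det:
  fixes f :: "'a::complex_affine \<Rightarrow> complex ^ 'n ^ 'n"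
  shows "regular_map_at w f \<Longrightarrow> regular_at w (\<lambda>x. det (f x))"
  unfolding regular_map_at_matrix det_def by (auto intro!: regular_intros)

lemma regular_coeff_prod:
  assumes "\<And>i k. i \<in> S \<Longrightarrow> regular_at w (\<lambda>x. coeff (F i x) k)"
  shows "regular_at w (\<lambda>x. coeff (\<Prod>i\<in>S. F i x) k)"
  using assms
  by (induction S arbitrary: k rule: infinite_finite_induct) (auto simp: coeff_mult intro!: regular_intros)

lemma regular_coeff_charpoly:
  fixes f :: "'a::complex_affine \<Rightarrow> complex ^ 'n ^ 'n"
  assumes "regular_map_at w f"
  shows "regular_at w (\<lambda>x. coeff (charpoly (f x)) k)"
proof -
  have entry: "regular_at w (\<lambda>x. coeff [:- (f x $ i $ j), c:] k)" for i j k c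
  proof -
    have "coeff [:- (f x $ i $ j), c:] k = (if k = 0 then - (f x $ i $ j) else if k = 1 then c else 0)" for x
      by (auto simp: coeff_pCons split: nat.splits)
    then show ?thesis
      using assms unfolding regular_map_at_matrix by (auto intro!: regular_intros)
  qed
  show ?thesis
    unfolding charpoly_def det_def coeff_sum
    by (auto simp: of_int_poly intro!: regular_intros regular_coeff_prod entry)
qed

lemma regular_matpow:
  fixes f :: "'a::complex_affine \<Rightarrow> complex ^ 'n ^ 'n"
  assumes "regular_map_at w f"
  shows "regular_map_at w (\<lambda>x. matpow (f x) k)"
proof (induction k)
  case 0
  show ?case by (simp add: matpow_def regular_map_at_matrix)
next
  case (Suc k)
  have "matpow a (Suc k) = a ** matpow a k" for a :: "complex ^ 'n ^ 'n"
    by (simp add: matpow_def)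
  then show ?case using regular_matrix_mult[OF assms Suc] by simp
qed

lemma regular_disc:
  fixes f :: "'a::complex_affine \<Rightarrow> complex ^ 'n ^ 'n"
  assumes "regular_map_at w f"
  shows "regular_at w (\<lambda>x. disc (f x))"
  unfolding disc_def
proof (rule regular_det)
  have "regular_at w (\<lambda>x. matpow (f x) k $ i $ j)" for k i j
    using regular_matpow[OF assms] by (auto simp: regular_map_at_matrix)
  moreover have "regular_at w (\<lambda>x. coeff (pderiv (charpoly (f x))) k)" for k
    using regular_coeff_charpoly[OF assms] by (auto simp: coeff_pderiv intro!: regular_intros)
  ultimately show "regular_map_at w (\<lambda>x. matrix_poly (pderiv (charpoly (f x))) (f x))"
    by (auto simp: regular_map_at_matrix matrix_poly_def mat_mult_component intro!: regular_intros)
qed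

lemma regular_sylvester:
  fixes f g :: "'a::complex_affine \<Rightarrow> complex ^ 'n ^ 'n"
  assumes "regular_map_at w f" "regular_map_at w g"
  shows "regular_map_at w (\<lambda>x. sylvester (f x) (g x))"
  using assms by (auto simp: regular_map_at_matrix sylvester_def intro!: regular_intros)

lemma regular_sylvester_solution:
  fixes f g :: "'a::complex_affine \<Rightarrow> complex ^ 'n ^ 'n"
  assumes "regular_map_at w f" "regular_map_at w g" "det (sylvester (f w) (g w)) \<noteq> 0"
  shows "regular_map_at w (\<lambda>x. sylvester_solution (f x) (g x))"
proof -
  note syl = regular_sylvester[OF assms(1,2)]
  have "regular_at w (\<lambda>x. if b then k else sylvester (f x) (g x) $ p $ q)" for b k p q
    by (intro regular_if regular_const syl[unfolded regular_map_at_matrix, rule_format])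
  then show ?thesis
    unfolding regular_map_at_matrix sylvester_solution_def vec_lambda_beta
    by (intro allI regular_divide regular_det syl assms(3)) (simp add: regular_map_at_matrix)
qed

lemma regular_matrix_inv:
  fixes f :: "'a::complex_affine \<Rightarrow> complex ^ 'n ^ 'n"
  assumes "regular_map_at w f" "det (f w) \<noteq> 0"
  shows "regular_map_at w (\<lambda>x. matrix_inv (f x))"
  unfolding regular_map_at_matrix
proof (intro allI)
  fix i j
  note near = near_nonzero[OF regular_det[OF assms(1)] assms(2)]
  have "regular_at w (\<lambda>x. if b then k else f x $ p $ q)" for b k p q
    using assms(1) by (auto simp: regular_map_at_matrix intro!: regular_intros)
  then have "regular_at w (\<lambda>x. det (\<chi> k l. if l = i then axis j 1 $ k else f x $ k $ l) / det (f x))"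
    by (intro regular_divide regular_det assms) (simp add: regular_map_at_matrix)
  then show "regular_at w (\<lambda>x. matrix_inv (f x) $ i $ j)"
    by (rule regular_at_cong[rotated]) (rule near_mono[OF near], rule matrix_inv_cramer)
qed

section \<open>The refactorization map near the witness points\<close>

text \<open>
  The inequalities under which all assertions about a single pair hold; each of them is the
  nonvanishing of a rational function of the pair.
\<close>

definition good :: "(complex ^ 'm ^ 'm) \<times> (complex ^ 'm ^ 'm) \<Rightarrow> bool" where
  "good a \<longleftrightarrow> disc (fst a) \<noteq> 0 \<and> disc (snd a) \<noteq> 0 \<and> det (sylvester (fst a) (snd a)) \<noteq> 0 \<and>
     det (sylvester_solution (fst a) (snd a)) \<noteq> 0"

definition explicit_map ::
  "(complex ^ 'm ^ 'm) \<times> (complex ^ 'm ^ 'm) \<Rightarrow> (complex ^ 'm ^ 'm) \<times> (complex ^ 'm ^ 'm)" where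
  "explicit_map a = (let N = matrix_inv (sylvester_solution (fst a) (snd a)) in (fst a + N, snd a - N))"

lemma good_spectra:
  fixes a1 a2 :: "complex ^ 'm ^ 'm"
  assumes "good (a1, a2)"
  shows "card (eigenvalues a1) = CARD('m)" "card (eigenvalues a2) = CARD('m)"
    "eigenvalues a1 \<inter> eigenvalues a2 = {}"
  using assms card_eigenvalues_if_disc eigenvalues_disjoint_if_sylvester[of a1 a2]
  by (auto simp: good_def)

lemma good_sylvester_iff:
  "good (a1, a2) \<Longrightarrow> a2 ** L - L ** a1 = mat 1 \<longleftrightarrow> L = sylvester_solution a1 a2"
  by (simp add: good_def sylvester_solution_iff)

lemma good_refactorization:
  assumes "good a"
  shows "refactorization a b \<longleftrightarrow> b = explicit_map a"
proof -
  obtain a1 a2 where [simp]: "a = (a1, a2)" by (cases a)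
  have "refactorization a (explicit_map a)"
    using assms good_sylvester_iff[of a1 a2 "sylvester_solution a1 a2"]
      refactorization_from_sylvester[of a2 "sylvester_solution a1 a2" a1]
    by (simp add: explicit_map_def good_def invertible_det_nz Let_def)
  then show ?thesis
    using refactorization_unique[of a1 a2] good_spectra[of a1 a2] assms
    by (metis \<open>a = (a1, a2)\<close>)
qed

lemma good_refactorization_map: "good a \<Longrightarrow> refactorization_map a = explicit_map a"
  by (simp add: refactorization_map_def good_refactorization)

lemma good_refactorization_map_spec: "good a \<Longrightarrow> refactorization a (refactorization_map a)"
  by (simp add: good_refactorization good_refactorization_map)

text \<open>
  The original pair is a refactorization of its image, because the defining relation is symmetric;
  uniqueness at the image does the rest.
\<close>

lemma refactorization_map_involution:
  assumes "good a" "good (refactorization_map a)"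
  shows "refactorization_map (refactorization_map a) = a"
  using assms good_refactorization_map_spec[of a] good_refactorization[of "refactorization_map a" a]
  by (simp add: refactorization_sym good_refactorization_map)

text \<open>
  One diagonal matrix with distinct real entries, translated by imaginary scalars: two translates
  with different \<open>s\<close> have simple, disjoint spectra, and the solution \<open>\<Lambda>\<close> for them is scalar. The
  refactorization map just swaps them, so that all points visited in the braid relation are again
  of this kind.
\<close>

definition witness :: "real \<Rightarrow> complex ^ 'm::finite ^ 'm" where
  "witness s = diag (\<lambda>i. of_nat (to_nat_on UNIV i) + of_real s * \<i>)"

lemma diag_mult: "(diag d ** X) $ i $ j = d i * X $ i $ j" "(X ** diag d) $ i $ j = X $ i $ j * d j"
  by (simp_all add: matrix_matrix_mult_def diag_def mult_delta_left mult_delta_right)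

lemma disc_witness: "disc (witness s :: complex ^ 'm ^ 'm) \<noteq> 0"
  unfolding witness_def
  using inj_on_to_nat_on[OF countable_finite[OF finite], of "UNIV :: 'm set"]
  by (intro disc_diag) (simp add: inj_on_def)

text \<open>
  In the entry \<open>(i, j)\<close> the equation reads \<open>(n\<^sub>i - n\<^sub>j + (t - s) \<i>) X\<^sub>i\<^sub>j = 0\<close>, with \<open>n\<^sub>i\<close> and \<open>n\<^sub>j\<close>
  real.
\<close>

lemma sylvester_witness:
  assumes "s \<noteq> t"
  shows "det (sylvester (witness s) (witness t :: complex ^ 'm ^ 'm)) \<noteq> 0"
  unfolding det_nonzero_iff_kernel
proof (intro allI impI)
  fix x :: "complex ^ ('m \<times> 'm)"
  define X :: "complex ^ 'm ^ 'm" where "X = (\<chi> i j. x $ (i, j))"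
  have x: "x = flatten X" by (simp add: X_def flatten_def vec_eq_iff)
  assume "sylvester (witness s) (witness t) *v x = 0"
  then have 0: "flatten (witness t ** X - X ** witness s) = 0"
    by (simp add: x sylvester_flatten)
  have "X $ i $ j = 0" for i j
  proof -
    define n :: "'m \<Rightarrow> complex" where "n = (\<lambda>k. of_nat (to_nat_on UNIV k))"
    have "(n i + of_real t * \<i>) * X $ i $ j - X $ i $ j * (n j + of_real s * \<i>) = 0"
      using arg_cong[OF 0, of "\<lambda>x. x $ (i, j)"]
      by (simp add: flatten_def witness_def diag_mult n_def)
    then have "(n i + of_real t * \<i> - (n j + of_real s * \<i>)) * X $ i $ j = 0"
      by (simp add: algebra_simps)
    moreover have "Im (n i + of_real t * \<i> - (n j + of_real s * \<i>)) \<noteq> 0"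
      using assms by (simp add: n_def)
    ultimately show ?thesis by (metis mult_eq_0_iff zero_complex.simps(2))
  qed
  then show "x = 0" by (simp add: x flatten_def vec_eq_iff)
qed

lemma sylvester_solution_witness:
  assumes "s \<noteq> t"
  shows "sylvester_solution (witness s) (witness t :: complex ^ 'm ^ 'm) = mat (1 / (of_real (t - s) * \<i>))"
proof -
  have c: "of_real (t - s) * \<i> \<noteq> (0 :: complex)" using assms by simp
  have "witness t ** mat k - mat k ** witness s = (mat (k * (of_real (t - s) * \<i>)) :: complex ^ 'm ^ 'm)" for k
    unfolding mat_mult_commute[symmetric]
    by (simp add: vec_eq_iff mat_mult_component) (simp add: witness_def diag_def mat_def algebra_simps)
  then have "witness t ** mat (1 / (of_real (t - s) * \<i>)) - mat (1 / (of_real (t - s) * \<i>)) ** witness s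
      = (mat 1 :: complex ^ 'm ^ 'm)"
    using c by (metis nonzero_divide_eq_eq)
  then show ?thesis
    using sylvester_solution_iff[OF sylvester_witness[OF assms]] by metis
qed

lemma det_scalar: "c \<noteq> 0 \<Longrightarrow> det (mat c :: complex ^ 'm ^ 'm) \<noteq> 0"
  by (subst det_diagonal) (auto simp: mat_def)

lemma good_witness: "s \<noteq> t \<Longrightarrow> good (witness s, witness t)"
  by (simp add: good_def disc_witness sylvester_witness sylvester_solution_witness det_scalar)

lemma explicit_map_witness:
  assumes "s \<noteq> t"
  shows "explicit_map (witness s, witness t :: complex ^ 'm ^ 'm) = (witness t, witness s)"
proof -
  define c where "c = of_real (t - s) * \<i>"
  have "c \<noteq> 0" using assms by (simp add: c_def)
  have "matrix_inv (mat (1 / c)) = (mat c :: complex ^ 'm ^ 'm)"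
  proof -
    have "mat (1 / c) ** (mat c :: complex ^ 'm ^ 'm) = mat 1"
      using \<open>c \<noteq> 0\<close> by (simp add: vec_eq_iff mat_mult_component) (simp add: mat_def)
    moreover from this have "(mat c :: complex ^ 'm ^ 'm) ** mat (1 / c) = mat 1"
      by (simp only: mat_mult_commute[of c])
    ultimately have "mat (1 / c) ** matrix_inv (mat (1 / c)) = (mat 1 :: complex ^ 'm ^ 'm)"
      unfolding matrix_inv_def by (rule_tac someI2[where a = "mat c"]) auto
    then have "mat c ** (mat (1 / c) ** matrix_inv (mat (1 / c))) = (mat c :: complex ^ 'm ^ 'm)"
      by simp
    then show ?thesis
      using \<open>(mat c :: complex ^ 'm ^ 'm) ** mat (1 / c) = mat 1\<close> by (simp add: matrix_mul_assoc)
  qed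
  moreover have "mat c = witness t - (witness s :: complex ^ 'm ^ 'm)"
    by (simp add: vec_eq_iff witness_def diag_def mat_def c_def algebra_simps)
  moreover have "sylvester_solution (witness s) (witness t :: complex ^ 'm ^ 'm) = mat (1 / c)"
    by (simp only: sylvester_solution_witness[OF assms] c_def)
  ultimately show ?thesis
    by (simp add: explicit_map_def Let_def)
qed

lemma refactorization_map_witness:
  "s \<noteq> t \<Longrightarrow> refactorization_map (witness s, witness t) = (witness t, witness s)"
  by (simp add: good_witness good_refactorization_map explicit_map_witness)

lemma near_good:
  assumes "good w"
  shows "near w (\<lambda>x. good x)"
proof -
  have fst: "regular_map_at w (\<lambda>x. fst x)" and snd: "regular_map_at w (\<lambda>x. snd x)"
    by (rule regular_map_at_fst regular_map_at_snd, rule regular_map_at_id)+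
  have nz: "disc (fst w) \<noteq> 0" "disc (snd w) \<noteq> 0" "det (sylvester (fst w) (snd w)) \<noteq> 0"
    "det (sylvester_solution (fst w) (snd w)) \<noteq> 0"
    using assms by (auto simp: good_def)
  have "near w (\<lambda>x. disc (fst x) \<noteq> 0)" "near w (\<lambda>x. disc (snd x) \<noteq> 0)"
    "near w (\<lambda>x. det (sylvester (fst x) (snd x)) \<noteq> 0)"
    "near w (\<lambda>x. det (sylvester_solution (fst x) (snd x)) \<noteq> 0)"
    by (rule near_nonzero[OF regular_disc[OF fst]] near_nonzero[OF regular_disc[OF snd]]
        near_nonzero[OF regular_det[OF regular_sylvester[OF fst snd]]]
        near_nonzero[OF regular_det[OF regular_sylvester_solution[OF fst snd nz(3)]]], rule nz)+
  then show ?thesis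
    unfolding good_def by (intro near_conj)
qed

lemma regular_map_at_add_diff:
  fixes f g :: "'a::complex_affine \<Rightarrow> complex ^ 'n ^ 'm"
  assumes "regular_map_at w f" "regular_map_at w g"
  shows "regular_map_at w (\<lambda>x. f x + g x)" "regular_map_at w (\<lambda>x. f x - g x)"
  using assms by (auto simp: regular_map_at_matrix)

lemma regular_refactorization_map:
  assumes "good w"
  shows "regular_map_at w refactorization_map"
proof (rule regular_map_at_cong)
  show "near w (\<lambda>x. refactorization_map x = (\<lambda>x. (fst x + matrix_inv (sylvester_solution (fst x) (snd x)),
      snd x - matrix_inv (sylvester_solution (fst x) (snd x)))) x)"
    by (rule near_mono[OF near_good[OF assms]]) (simp add: good_refactorization_map explicit_map_def Let_def)
  have fst: "regular_map_at w (\<lambda>x. fst x)" and snd: "regular_map_at w (\<lambda>x. snd x)"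
    by (rule regular_map_at_fst regular_map_at_snd, rule regular_map_at_id)+
  have inv: "regular_map_at w (\<lambda>x. matrix_inv (sylvester_solution (fst x) (snd x)))"
    by (rule regular_matrix_inv[OF regular_sylvester_solution[OF fst snd]])
       (use assms in \<open>auto simp: good_def\<close>)
  show "regular_map_at w (\<lambda>x. (fst x + matrix_inv (sylvester_solution (fst x) (snd x)),
      snd x - matrix_inv (sylvester_solution (fst x) (snd x))))"
    by (rule regular_map_at_Pair[OF regular_map_at_add_diff(1)[OF fst inv] regular_map_at_add_diff(2)[OF snd inv]])
qed

section \<open>The braid relation\<close>

abbreviation "\<sigma>1 \<equiv> sigma1 refactorization_map"
abbreviation "\<sigma>2 \<equiv> sigma2 refactorization_map"

definition first_pair :: "'u \<times> 'u \<times> 'u \<Rightarrow> 'u \<times> 'u" where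
  "first_pair x = (fst x, fst (snd x))"

definition last_pair :: "'u \<times> 'u \<times> 'u \<Rightarrow> 'u \<times> 'u" where
  "last_pair x = snd x"

lemma sigma1_eq: "sigma1 \<mu> x = (fst (\<mu> (first_pair x)), snd (\<mu> (first_pair x)), snd (snd x))"
  by (cases x) (simp add: sigma1_def first_pair_def split_beta)

lemma sigma2_eq: "sigma2 \<mu> x = (fst x, fst (\<mu> (last_pair x)), snd (\<mu> (last_pair x)))"
  by (cases x) (simp add: sigma2_def last_pair_def split_beta)

lemma regular_pairs: "regular_map_at w first_pair" "regular_map_at w last_pair"
proof -
  have 1: "regular_map_at w (\<lambda>x. fst x)" and 2: "regular_map_at w (\<lambda>x. snd x)"
    by (rule regular_map_at_fst regular_map_at_snd, rule regular_map_at_id)+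
  show "regular_map_at w first_pair"
    unfolding first_pair_def[abs_def] by (rule regular_map_at_Pair[OF 1 regular_map_at_fst[OF 2]])
  show "regular_map_at w last_pair"
    unfolding last_pair_def[abs_def] by (rule 2)
qed

lemma regular_sigma1:
  assumes "good (first_pair w)"
  shows "regular_map_at w \<sigma>1"
proof -
  have "regular_map_at w (\<lambda>x. refactorization_map (first_pair x))"
    by (rule regular_map_at_compose[OF regular_pairs(1) regular_refactorization_map[OF assms]])
  then have "regular_map_at w (\<lambda>x. (fst (refactorization_map (first_pair x)),
      snd (refactorization_map (first_pair x)), snd (snd x)))"
    by (intro regular_map_at_Pair regular_map_at_snd[OF regular_map_at_snd[OF regular_map_at_id]]
        regular_map_at_fst[of w "\<lambda>x. refactorization_map (first_pair x)"]
        regular_map_at_snd[of w "\<lambda>x. refactorization_map (first_pair x)"])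
  then show ?thesis unfolding sigma1_eq[abs_def] .
qed

lemma regular_sigma2:
  assumes "good (last_pair w)"
  shows "regular_map_at w \<sigma>2"
proof -
  have "regular_map_at w (\<lambda>x. refactorization_map (last_pair x))"
    by (rule regular_map_at_compose[OF regular_pairs(2) regular_refactorization_map[OF assms]])
  then have "regular_map_at w (\<lambda>x. (fst x, fst (refactorization_map (last_pair x)),
      snd (refactorization_map (last_pair x))))"
    by (intro regular_map_at_Pair regular_map_at_fst[OF regular_map_at_id]
        regular_map_at_fst[of w "\<lambda>x. refactorization_map (last_pair x)"]
        regular_map_at_snd[of w "\<lambda>x. refactorization_map (last_pair x)"])
  then show ?thesis unfolding sigma2_eq[abs_def] .
qed

lemma near_good_pairs:
  shows "good (first_pair w) \<Longrightarrow> near w (\<lambda>x. good (first_pair x))"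
    and "good (last_pair w) \<Longrightarrow> near w (\<lambda>x. good (last_pair x))"
  by (rule near_compose[OF regular_pairs(1)] near_compose[OF regular_pairs(2)], rule near_good, assumption)+

lemma sigma_involution:
  shows "good (first_pair x) \<Longrightarrow> good (first_pair (\<sigma>1 x)) \<Longrightarrow> \<sigma>1 (\<sigma>1 x) = x"
    and "good (last_pair x) \<Longrightarrow> good (last_pair (\<sigma>2 x)) \<Longrightarrow> \<sigma>2 (\<sigma>2 x) = x"
  by (cases x; simp add: sigma1_eq sigma2_eq first_pair_def last_pair_def
      refactorization_map_involution)+

lemma sigma1_step:
  assumes "good (first_pair (a1, a2, a3))" "\<sigma>1 (a1, a2, a3) = (b1, b2, b3)"
  shows "b3 = a3" "eigenvalues b1 = eigenvalues a2" "eigenvalues b2 = eigenvalues a1"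
    "b1 + b2 = a1 + a2" "(mat t - b1) ** (mat t - b2) = (mat t - a1) ** (mat t - a2)"
proof -
  have "refactorization (a1, a2) (b1, b2)" and "b3 = a3"
    using assms good_refactorization_map_spec[of "(a1, a2)"]
    by (auto simp: sigma1_eq first_pair_def)
  then show "b3 = a3" "eigenvalues b1 = eigenvalues a2" "eigenvalues b2 = eigenvalues a1"
    "b1 + b2 = a1 + a2" "(mat t - b1) ** (mat t - b2) = (mat t - a1) ** (mat t - a2)"
    by (auto simp: refactorization_pencil) (auto simp: refactorization_iff)
qed

lemma sigma2_step:
  assumes "good (last_pair (a1, a2, a3))" "\<sigma>2 (a1, a2, a3) = (b1, b2, b3)"
  shows "b1 = a1" "eigenvalues b2 = eigenvalues a3" "eigenvalues b3 = eigenvalues a2"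
    "b2 + b3 = a2 + a3" "(mat t - b2) ** (mat t - b3) = (mat t - a2) ** (mat t - a3)"
proof -
  have "refactorization (a2, a3) (b2, b3)" and "b1 = a1"
    using assms good_refactorization_map_spec[of "(a2, a3)"]
    by (auto simp: sigma2_eq last_pair_def)
  then show "b1 = a1" "eigenvalues b2 = eigenvalues a3" "eigenvalues b3 = eigenvalues a2"
    "b2 + b3 = a2 + a3" "(mat t - b2) ** (mat t - b3) = (mat t - a2) ** (mat t - a3)"
    by (auto simp: refactorization_pencil) (auto simp: refactorization_iff)
qed

text \<open>
  Both sides reverse the order of the three spectra and preserve the sum and the cubic pencil
  \<open>(t - a1) (t - a2) (t - a3)\<close>, so they are the same triple.
\<close>

lemma braid:
  fixes x :: "(complex ^ 'm ^ 'm) \<times> (complex ^ 'm ^ 'm) \<times> (complex ^ 'm ^ 'm)"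
  assumes l: "good (first_pair x)" "good (last_pair (\<sigma>1 x))" "good (first_pair (\<sigma>2 (\<sigma>1 x)))"
    and r: "good (last_pair x)" "good (first_pair (\<sigma>2 x))" "good (last_pair (\<sigma>1 (\<sigma>2 x)))"
  shows "\<sigma>1 (\<sigma>2 (\<sigma>1 x)) = \<sigma>2 (\<sigma>1 (\<sigma>2 x))"
proof -
  obtain a1 a2 a3 where x: "x = (a1, a2, a3)" by (cases x)
  obtain b1 b2 b3 where b: "\<sigma>1 (a1, a2, a3) = (b1, b2, b3)" by (cases "\<sigma>1 (a1, a2, a3)")
  obtain c1 c2 c3 where c: "\<sigma>2 (b1, b2, b3) = (c1, c2, c3)" by (cases "\<sigma>2 (b1, b2, b3)")
  obtain d1 d2 d3 where d: "\<sigma>1 (c1, c2, c3) = (d1, d2, d3)" by (cases "\<sigma>1 (c1, c2, c3)")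
  obtain e1 e2 e3 where e: "\<sigma>2 (a1, a2, a3) = (e1, e2, e3)" by (cases "\<sigma>2 (a1, a2, a3)")
  obtain f1 f2 f3 where f: "\<sigma>1 (e1, e2, e3) = (f1, f2, f3)" by (cases "\<sigma>1 (e1, e2, e3)")
  obtain g1 g2 g3 where g: "\<sigma>2 (f1, f2, f3) = (g1, g2, g3)" by (cases "\<sigma>2 (f1, f2, f3)")
  note good = l(1)[unfolded x] l(2)[unfolded x b] l(3)[unfolded x b c]
    r(1)[unfolded x] r(2)[unfolded x e] r(3)[unfolded x e f]
  note steps = sigma1_step[OF good(1) b] sigma2_step[OF good(2) c] sigma1_step[OF good(3) d]
    sigma2_step[OF good(4) e] sigma1_step[OF good(5) f] sigma2_step[OF good(6) g]
  have spectra: "eigenvalues d1 = eigenvalues a3" "eigenvalues d2 = eigenvalues a2"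
    "eigenvalues d3 = eigenvalues a1" "eigenvalues g1 = eigenvalues a3"
    "eigenvalues g2 = eigenvalues a2" "eigenvalues g3 = eigenvalues a1"
    using steps(1,2,3,6,7,8,11,12,13,16,17,18,21,22,23,26,27,28) by simp_all
  have ab: "good (a1, a2)" "good (b2, a3)" "good (a2, a3)"
    using good(1,2,4) steps(1) by (simp_all add: first_pair_def last_pair_def)
  have disj: "eigenvalues a3 \<inter> eigenvalues a2 = {}" "eigenvalues a3 \<inter> eigenvalues a1 = {}"
    "eigenvalues a2 \<inter> eigenvalues a1 = {}"
    using ab[THEN good_spectra(3)] steps(3) by (simp_all add: Int_commute)
  have "(d1, d2, d3) = (g1, g2, g3)"
  proof (rule triple_refactorization_unique)
    have "d1 + d2 + d3 = a1 + a2 + a3"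
    proof -
      have "d1 + d2 + d3 = c1 + (c2 + c3)" using steps(11,14) by (simp add: add.assoc)
      also have "\<dots> = b1 + b2 + a3" using steps(1,6,9) by (simp add: add.assoc)
      finally show ?thesis using steps(4) by simp
    qed
    moreover have "g1 + g2 + g3 = a1 + a2 + a3"
    proof -
      have "g1 + g2 + g3 = f1 + f2 + f3" using steps(26,29) by (simp add: add.assoc)
      also have "\<dots> = a1 + (e2 + e3)" using steps(16,21,24) by (simp add: add.assoc)
      finally show ?thesis using steps(19) by (simp add: add.assoc)
    qed
    ultimately show "d1 + d2 + d3 = g1 + g2 + g3" by simp
    fix t
    have "(mat t - d1) ** (mat t - d2) ** (mat t - d3) = (mat t - b1) ** ((mat t - c2) ** (mat t - c3))"
      using steps(6,11,15) by (simp add: matrix_mul_assoc)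
    also have "\<dots> = (mat t - a1) ** (mat t - a2) ** (mat t - a3)"
      using steps(1,5,10) by (simp add: matrix_mul_assoc)
    also have "\<dots> = (mat t - a1) ** (mat t - e2) ** (mat t - e3)"
      using steps(20) by (simp add: matrix_mul_assoc[symmetric])
    also have "\<dots> = (mat t - f1) ** (mat t - f2) ** (mat t - f3)"
      using steps(16,21,25) by simp
    also have "\<dots> = (mat t - g1) ** (mat t - g2) ** (mat t - g3)"
      using steps(26,30) by (simp add: matrix_mul_assoc[symmetric])
    finally show "(mat t - d1) ** (mat t - d2) ** (mat t - d3)
      = (mat t - g1) ** (mat t - g2) ** (mat t - g3)" .
  qed (simp_all add: spectra disj ab(1,3)[THEN good_spectra(1)])
  then show ?thesis by (simp add: x b c d e f g)
qed

lemma sigma_witness: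
  shows "r \<noteq> s \<Longrightarrow> \<sigma>1 (witness r, witness s, witness t) = (witness s, witness r, witness t)"
    and "s \<noteq> t \<Longrightarrow> \<sigma>2 (witness r, witness s, witness t) = (witness r, witness t, witness s)"
  by (simp_all add: sigma1_eq sigma2_eq first_pair_def last_pair_def refactorization_map_witness)

lemma good_pairs_witness:
  shows "r \<noteq> s \<Longrightarrow> good (first_pair (witness r, witness s, z))"
    and "s \<noteq> t \<Longrightarrow> good (last_pair (z, witness s, witness t))"
  by (simp_all add: first_pair_def last_pair_def good_witness)

lemma same_rational_map_if_near: "near w (\<lambda>x. f x = g x) \<Longrightarrow> same_rational_map f g"
  unfolding same_rational_map_def by (rule generically_if_near)

lemma birational_refactorization_map:
  "birational_automorphism (refactorization_map :: (complex ^ 'm ^ 'm) \<times> (complex ^ 'm ^ 'm) \<Rightarrow> _)"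
proof -
  let ?w = "(witness 0, witness 1) :: (complex ^ 'm ^ 'm) \<times> (complex ^ 'm ^ 'm)"
  have good: "good ?w" "good (refactorization_map ?w)"
    by (simp_all add: good_witness refactorization_map_witness)
  have "near ?w (\<lambda>x. good x \<and> good (refactorization_map x))"
    by (rule near_conj[OF near_good[OF good(1)]
          near_compose[OF regular_refactorization_map[OF good(1)] near_good[OF good(2)]]])
  then have "near ?w (\<lambda>x. (refactorization_map \<circ> refactorization_map) x = id x)"
    by (rule near_mono) (simp add: refactorization_map_involution)
  moreover have "rational_map (refactorization_map :: (complex ^ 'm ^ 'm) \<times> (complex ^ 'm ^ 'm) \<Rightarrow> _)"
    using regular_refactorization_map[OF good(1)] by (rule rational_map_if_regular)
  ultimately show ?thesis
    unfolding birational_automorphism_def using same_rational_map_if_near by blast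
qed

lemma twisted_transposition_refactorization_map:
  "twisted_transposition (refactorization_map :: (complex ^ 'm ^ 'm) \<times> (complex ^ 'm ^ 'm) \<Rightarrow> _)"
proof -
  let ?w = "(witness 0, witness 1, witness 2) ::
    (complex ^ 'm ^ 'm) \<times> (complex ^ 'm ^ 'm) \<times> (complex ^ 'm ^ 'm)"
  have reg1: "regular_map_at ?w \<sigma>1" and reg2: "regular_map_at ?w \<sigma>2"
    by (simp_all add: regular_sigma1 regular_sigma2 good_pairs_witness)
  have reg21: "regular_map_at ?w (\<lambda>x. \<sigma>2 (\<sigma>1 x))" and reg12: "regular_map_at ?w (\<lambda>x. \<sigma>1 (\<sigma>2 x))"
    by (rule regular_map_at_compose[OF reg1] regular_map_at_compose[OF reg2],
        simp add: regular_sigma1 regular_sigma2 good_pairs_witness sigma_witness)+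
  have l: "near ?w (\<lambda>x. good (first_pair x))" "near ?w (\<lambda>x. good (last_pair (\<sigma>1 x)))"
    "near ?w (\<lambda>x. good (first_pair (\<sigma>2 (\<sigma>1 x))))" "near ?w (\<lambda>x. good (first_pair (\<sigma>1 x)))"
    by (rule near_good_pairs near_compose[OF reg1] near_compose[OF reg21],
        simp add: near_good_pairs good_pairs_witness sigma_witness)+
  have r: "near ?w (\<lambda>x. good (last_pair x))" "near ?w (\<lambda>x. good (first_pair (\<sigma>2 x)))"
    "near ?w (\<lambda>x. good (last_pair (\<sigma>1 (\<sigma>2 x))))" "near ?w (\<lambda>x. good (last_pair (\<sigma>2 x)))"
    by (rule near_good_pairs near_compose[OF reg2] near_compose[OF reg12],
        simp add: near_good_pairs good_pairs_witness sigma_witness)+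
  have "near ?w (\<lambda>x. (\<sigma>1 \<circ> \<sigma>1) x = id x)"
    by (rule near_mono[OF near_conj[OF l(1,4)]]) (simp add: sigma_involution)
  moreover have "near ?w (\<lambda>x. (\<sigma>2 \<circ> \<sigma>2) x = id x)"
    by (rule near_mono[OF near_conj[OF r(1,4)]]) (simp add: sigma_involution)
  moreover have "near ?w (\<lambda>x. (\<sigma>1 \<circ> \<sigma>2 \<circ> \<sigma>1) x = (\<sigma>2 \<circ> \<sigma>1 \<circ> \<sigma>2) x)"
    by (rule near_mono[OF near_conj[OF near_conj[OF near_conj[OF l(1,2)] l(3)]
          near_conj[OF near_conj[OF r(1,2)] r(3)]]])
       (simp add: braid)
  ultimately show ?thesis
    unfolding twisted_transposition_def
    using birational_refactorization_map same_rational_map_if_near by blast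
qed

theorem mainTheorem1:
  fixes \<mu> :: "(complex ^ 'm ^ 'm) \<times> (complex ^ 'm ^ 'm) \<Rightarrow> (complex ^ 'm ^ 'm) \<times> (complex ^ 'm ^ 'm)"
  assumes "\<mu> = refactorization_map"
  shows "generically (\<lambda>(a1, a2).
           card (eigenvalues a1) = CARD('m) \<and> card (eigenvalues a2) = CARD('m) \<and>
           eigenvalues a1 \<inter> eigenvalues a2 = {} \<and>
           (\<exists>!b. refactorization (a1, a2) b) \<and>
           (\<exists>!\<Lambda>. a2 ** \<Lambda> - \<Lambda> ** a1 = mat 1) \<and>
           (\<forall>\<Lambda>. a2 ** \<Lambda> - \<Lambda> ** a1 = mat 1 \<longrightarrow>
              invertible \<Lambda> \<and> \<mu> (a1, a2) = (a1 + matrix_inv \<Lambda>, a2 - matrix_inv \<Lambda>)))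
         \<and> twisted_transposition \<mu>"
proof
  have "near (witness 0, witness 1 :: complex ^ 'm ^ 'm) good"
    by (simp add: near_good good_witness)
  then show "generically (\<lambda>(a1, a2).
           card (eigenvalues a1) = CARD('m) \<and> card (eigenvalues a2) = CARD('m) \<and>
           eigenvalues a1 \<inter> eigenvalues a2 = {} \<and>
           (\<exists>!b. refactorization (a1, a2) b) \<and>
           (\<exists>!\<Lambda>. a2 ** \<Lambda> - \<Lambda> ** a1 = mat 1) \<and>
           (\<forall>\<Lambda>. a2 ** \<Lambda> - \<Lambda> ** a1 = mat 1 \<longrightarrow>
              invertible \<Lambda> \<and> \<mu> (a1, a2) = (a1 + matrix_inv \<Lambda>, a2 - matrix_inv \<Lambda>)))"
  proof (intro generically_if_near, rule near_mono, clarify)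
    fix a1 a2 :: "complex ^ 'm ^ 'm"
    assume good: "good (a1, a2)"
    have "invertible (sylvester_solution a1 a2)"
      using good by (simp add: good_def invertible_det_nz)
    moreover have "\<mu> (a1, a2) = (a1 + matrix_inv (sylvester_solution a1 a2), a2 - matrix_inv (sylvester_solution a1 a2))"
      using good by (simp add: assms good_refactorization_map explicit_map_def Let_def)
    ultimately show "card (eigenvalues a1) = CARD('m) \<and> card (eigenvalues a2) = CARD('m) \<and>
           eigenvalues a1 \<inter> eigenvalues a2 = {} \<and>
           (\<exists>!b. refactorization (a1, a2) b) \<and>
           (\<exists>!\<Lambda>. a2 ** \<Lambda> - \<Lambda> ** a1 = mat 1) \<and>
           (\<forall>\<Lambda>. a2 ** \<Lambda> - \<Lambda> ** a1 = mat 1 \<longrightarrow>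
              invertible \<Lambda> \<and> \<mu> (a1, a2) = (a1 + matrix_inv \<Lambda>, a2 - matrix_inv \<Lambda>))"
      using good_spectra[OF good] good_refactorization[OF good] good_sylvester_iff[OF good]
      by simp
  qed
  show "twisted_transposition \<mu>"
    unfolding assms by (rule twisted_transposition_refactorization_map)
qed

end
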